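(* For each integer $n \ge 0$, let $a(n)$ be the number of binary strings of length $2n$ with exactly $n$ ones, counted up to reversal. Then for every integer $n \ge 6$, $$ \begin{aligned} &n(n-1)\,a(n) - 2(n-1)(3n-4)\,a(n-1) + 4(2n^{2}-14n+19)\,a(n-2) \\ &\quad + 8(n^{2}+5n-19)\,a(n-3) - 16(n-3)(3n-10)\,a(n-4) + 32(n-4)(2n-9)\,a(n-5) = 0 . \end{aligned} $$
   Context: Let $X_n$ be the set of binary strings $s_1 s_2 \ldots s_{2n}$ (each $s_i \in \{0,1\}$) of length $2n$ with exactly $n$ entries equal to $1$. The reversal map $\rho : X_n \to X_n$, $\rho(s_1 s_2 \ldots s_{2n}) = s_{2n} s_{2n-1} \ldots s_1$, is an involution. "Counted up to reversal" means that $a(n)$ is the number of orbits of the group $\langle \rho \rangle$ acting on $X_n$, i.e. the number of equivalence classes of $X_n$ under the relation identifying each string with its reversal. (This is OEIS sequence A032123; the first values, starting at $n=0$, are $1, 1, 4, 10, 38, 126, 472, 1716, \ldots$.) *)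

theory Defs
  imports Complex_Main
begin

text \<open>Binary strings are Boolean lists, with \<open>True\<close> for the entry 1 and \<open>False\<close> for 0.\<close>

definition balanced_strings :: "nat \<Rightarrow> bool list set" where
  "balanced_strings n = {s. length s = 2 * n \<and> count_list s True = n}"

definition reversal_rel :: "nat \<Rightarrow> (bool list \<times> bool list) set" where
  "reversal_rel n =
     {(s, t). s \<in> balanced_strings n \<and> t \<in> balanced_strings n \<and> (t = s \<or> t = rev s)}"

lemma rev_in_balanced_strings: "s \<in> balanced_strings n \<Longrightarrow> rev s \<in> balanced_strings n"
  by (simp add: balanced_strings_def)

lemma equiv_reversal_rel: "equiv (balanced_strings n) (reversal_rel n)"
  by (rule equivI) (auto simp: reversal_rel_def refl_on_def sym_def trans_def)

definition num_up_to_reversal :: "nat \<Rightarrow> nat" where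
  "num_up_to_reversal n = card (balanced_strings n // reversal_rel n)"

end

theory Submission
  imports Defs
begin

text \<open>
  Every class of strings under reversal is a pair \<open>{s, rev s}\<close>, which collapses to a single
  string exactly when \<open>s\<close> is a palindrome. Hence \<open>2 a(n) = c(n) + p(n)\<close>, where \<open>c(n)\<close> is the
  central binomial coefficient and \<open>p(n)\<close> counts the palindromes. A palindrome is determined by
  its first half, which carries half of the ones, so \<open>p(n)\<close> is the central binomial
  coefficient \<open>n choose n/2\<close> for even \<open>n\<close>, and zero for odd \<open>n\<close>
  (lemma \<open>twice_num_up_to_reversal\<close>).

  Both sequences satisfy a recurrence with two terms:
  \<open>n c(n) = (4n - 2) c(n-1)\<close> and \<open>n p(n) = 4(n-1) p(n-2)\<close>.
  The recurrence for \<open>a\<close> is linear, and as an operator in the shift \<open>n \<mapsto> n - 1\<close> it is a common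
  left multiple of these two: dividing it on the right by either of them leaves no remainder.
  It therefore annihilates \<open>c\<close> and \<open>p\<close> separately, and so also \<open>(c + p) / 2\<close>.
  The quotients are written out as the coefficients of the \<open>r i\<close> in \<open>operator_annihilates_central\<close> and
  \<open>operator_annihilates_palindromes\<close>.
\<close>

section \<open>Orbits of an involution\<close>

text \<open>
  Summed over the classes, the number of elements plus the number of fixed points gives 2 for
  each class: a class is either a pair without fixed points or a single fixed point.
\<close>

lemma twice_card_orbits_involution:
  assumes fin: "finite A"
    and closed: "\<And>x. x \<in> A \<Longrightarrow> f x \<in> A"
    and invol: "\<And>x. x \<in> A \<Longrightarrow> f (f x) = x"
    and eq: "equiv A R"
    and R: "R = {(x, y). x \<in> A \<and> y \<in> A \<and> (y = x \<or> y = f x)}"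
  shows "2 * card (A // R) = card A + card {x \<in> A. f x = x}"
proof -
  define F where "F = {x \<in> A. f x = x}"
  have "F \<subseteq> A" and finF: "finite F" using fin by (auto simp: F_def)
  have fin_classes: "finite (A // R)"
    using fin eq by (simp add: finite_quotient equiv_type)
  have class_fin: "finite C" if "C \<in> A // R" for C
    using fin eq that in_quotient_imp_subset finite_subset by metis
  have Un: "\<Union>(A // R) = A" by (rule Union_quotient[OF eq])
  have disj: "C \<inter> D = {}" if "C \<in> A // R" "D \<in> A // R" "C \<noteq> D" for C D
    using quotient_disj[OF eq] that by blast
  have cardA: "card A = (\<Sum>C\<in>A // R. card C)"
    using card_Union_disjoint[of "A // R"] Un disj class_fin
    by (simp add: pairwise_def disjnt_def)
  have "F = (\<Union>C\<in>A // R. C \<inter> F)" using Un \<open>F \<subseteq> A\<close> by blast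
  then have cardF: "card F = (\<Sum>C\<in>A // R. card (C \<inter> F))"
    using card_UN_disjoint[OF fin_classes, of "\<lambda>C. C \<inter> F"] disj finF by fastforce
  have "card C + card (C \<inter> F) = 2" if "C \<in> A // R" for C
  proof -
    obtain x where x: "x \<in> A" "C = R `` {x}" using \<open>C \<in> A // R\<close> by (rule quotientE)
    have C: "C = {x, f x}" using x closed by (auto simp: R)
    show ?thesis
    proof (cases "f x = x")
      case True
      then have "C = {x}" "C \<inter> F = {x}" using C x by (auto simp: F_def)
      then show ?thesis by simp
    next
      case False
      then have "C \<inter> F = {}" using C x invol by (auto simp: F_def)
      then show ?thesis using C False by simp
    qed
  qed
  then have "(\<Sum>C\<in>A // R. card C + card (C \<inter> F)) = (\<Sum>C\<in>A // R. 2)"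
    by (rule sum.cong[OF refl])
  then show ?thesis using cardA cardF by (simp add: sum.distrib F_def)
qed

section \<open>Counting strings and palindromes\<close>

lemma finite_bool_lists_count: "finite {s :: bool list. length s = n \<and> count_list s True = k}"
  by (rule finite_subset[OF _ finite_lists_length_eq[of "UNIV :: bool set" n]]) auto

text \<open>Splitting off the first letter is Pascal's rule.\<close>

lemma card_bool_lists_count:
  "card {s :: bool list. length s = n \<and> count_list s True = k} = n choose k"
proof (induction n arbitrary: k)
  case 0
  have "{s :: bool list. length s = 0 \<and> count_list s True = k} = (if k = 0 then {[]} else {})"
    by auto
  then show ?case by simp
next
  case (Suc n)
  let ?S = "\<lambda>n k. {s :: bool list. length s = n \<and> count_list s True = k}"
  have split: "?S (Suc n) k = (#) False ` ?S n k \<union> (#) True ` {s. length s = n \<and> Suc (count_list s True) = k}"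
    by (auto simp: length_Suc_conv image_iff split: if_splits)
  show ?case
  proof (cases k)
    case 0
    then have "?S (Suc n) k = (#) False ` ?S n k" using split by auto
    then show ?thesis using Suc.IH[of k] 0 by (simp add: card_image)
  next
    case (Suc j)
    then have "?S (Suc n) k = (#) False ` ?S n k \<union> (#) True ` ?S n j" using split by auto
    moreover have "card ((#) False ` ?S n k \<union> (#) True ` ?S n j) = card (?S n k) + card (?S n j)"
      using finite_bool_lists_count
      by (subst card_Un_disjoint) (auto simp: card_image)
    ultimately show ?thesis using Suc.IH[of k] Suc.IH[of j] Suc by simp
  qed
qed

definition central_binomial :: "nat \<Rightarrow> int" where
  "central_binomial n = int (2 * n choose n)"

definition num_palindromes :: "nat \<Rightarrow> int" where
  "num_palindromes n = (if even n then central_binomial (n div 2) else 0)"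

lemma even_length_palindrome_iff:
  assumes "length s = 2 * n"
  shows "rev s = s \<longleftrightarrow> (\<exists>u. length u = n \<and> s = u @ rev u)"
proof
  assume pal: "rev s = s"
  have "s = take n s @ drop n s" by simp
  moreover have "drop n s = rev (take n s)"
    using pal assms rev_take[of n s] by simp
  ultimately show "\<exists>u. length u = n \<and> s = u @ rev u"
    using assms by (intro exI[of _ "take n s"]) auto
qed auto

lemma card_balanced_palindromes:
  "int (card {s \<in> balanced_strings n. rev s = s}) = num_palindromes n"
proof -
  let ?H = "{u :: bool list. length u = n \<and> 2 * count_list u True = n}"
  have "{s \<in> balanced_strings n. rev s = s} = (\<lambda>u. u @ rev u) ` ?H"
    by (auto simp: balanced_strings_def even_length_palindrome_iff)
  moreover have "inj_on (\<lambda>u. u @ rev u) {u :: bool list. length u = n}"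
    by (simp add: inj_on_def)
  then have "inj_on (\<lambda>u. u @ rev u) ?H"
    by (rule inj_on_subset) blast
  ultimately have card_half: "card {s \<in> balanced_strings n. rev s = s} = card ?H"
    by (simp add: card_image)
  show ?thesis
  proof (cases "even n")
    case True
    then have "2 * j = n \<longleftrightarrow> j = n div 2" for j by presburger
    then have "?H = {u. length u = n \<and> count_list u True = n div 2}" by presburger
    then show ?thesis
      using card_half card_bool_lists_count[of n "n div 2"] True
      by (simp add: num_palindromes_def central_binomial_def)
  next
    case False
    then have "2 * j \<noteq> n" for j by presburger
    then have "?H = {}" by blast
    then have "card ?H = 0" by (simp only: card.empty)
    then show ?thesis using card_half False by (simp add: num_palindromes_def)
  qed
qed

lemma twice_num_up_to_reversal:
  "2 * int (num_up_to_reversal n) = central_binomial n + num_palindromes n"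
proof -
  have "2 * num_up_to_reversal n
      = card (balanced_strings n) + card {s \<in> balanced_strings n. rev s = s}"
    unfolding num_up_to_reversal_def
  proof (rule twice_card_orbits_involution)
    show "finite (balanced_strings n)"
      unfolding balanced_strings_def by (rule finite_bool_lists_count)
  qed (rule equiv_reversal_rel reversal_rel_def | simp add: rev_in_balanced_strings)+
  moreover have "int (card (balanced_strings n)) = central_binomial n"
    unfolding balanced_strings_def central_binomial_def by (simp add: card_bool_lists_count)
  ultimately show ?thesis using card_balanced_palindromes[of n] by linarith
qed

section \<open>The two-term recurrences\<close>

lemma central_binomial_Suc:
  "(int k + 1) * central_binomial (Suc k) = (4 * int k + 2) * central_binomial k"
proof -
  have "Suc k * (Suc (2 * k + 1) choose Suc k) = Suc (2 * k + 1) * (2 * k + 1 choose k)"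
    by (rule Suc_times_binomial)
  also have "\<dots> = 2 * (Suc k * (2 * k + 1 choose k))"
    by simp
  also have "(2 * k + 1 choose k) = (Suc (2 * k) choose Suc k)"
    using binomial_symmetric[of k "2 * k + 1"] by simp
  also have "Suc k * \<dots> = Suc (2 * k) * (2 * k choose k)"
    by (rule Suc_times_binomial)
  finally have "Suc k * (2 * Suc k choose Suc k) = (4 * k + 2) * (2 * k choose k)"
    by (simp del: binomial_Suc_Suc)
  then have "int (Suc k * (2 * Suc k choose Suc k)) = int ((4 * k + 2) * (2 * k choose k))"
    by (rule arg_cong)
  then show ?thesis
    unfolding central_binomial_def of_nat_mult by (simp add: algebra_simps)
qed

lemma central_binomial_recurrence:
  assumes "n \<ge> 1"
  shows "int n * central_binomial n = (4 * int n - 2) * central_binomial (n - 1)"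
proof -
  obtain k where "n = Suc k" using assms by (cases n) auto
  then show ?thesis using central_binomial_Suc[of k] by (simp add: algebra_simps)
qed

lemma num_palindromes_recurrence:
  assumes "n \<ge> 2"
  shows "int n * num_palindromes n = 4 * (int n - 1) * num_palindromes (n - 2)"
proof (cases "even n")
  case True
  then obtain k where "n = 2 * Suc k"
    using assms by (metis Suc_pred dvdE gr0I mult_0_right not_numeral_le_zero)
  then show ?thesis
    using central_binomial_Suc[of k] by (simp add: num_palindromes_def algebra_simps)
next
  case False
  then show ?thesis using assms by (simp add: num_palindromes_def)
qed

section \<open>The recurrence operator\<close>

definition recurrence_operator :: "(nat \<Rightarrow> int) \<Rightarrow> nat \<Rightarrow> int" where
  "recurrence_operator a n =
     int n * (int n - 1) * a n
     - 2 * (int n - 1) * (3 * int n - 4) * a (n - 1)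
     + 4 * (2 * (int n)^2 - 14 * int n + 19) * a (n - 2)
     + 8 * ((int n)^2 + 5 * int n - 19) * a (n - 3)
     - 16 * (int n - 3) * (3 * int n - 10) * a (n - 4)
     + 32 * (int n - 4) * (2 * int n - 9) * a (n - 5)"

lemma operator_annihilates_central:
  assumes "n \<ge> 6"
  shows "recurrence_operator central_binomial n = 0"
proof -
  let ?c = central_binomial
  define N where "N = int n"
  define r where "r i = (N - int i) * ?c (n - i) - (4 * (N - int i) - 2) * ?c (n - Suc i)" for i
  have r_zero: "r i = 0" if "i \<le> 4" for i
    using central_binomial_recurrence[of "n - i"] assms that
    by (simp add: r_def N_def)
  \<comment> \<open>The factors in front of the defects \<open>r i\<close> come from right division of the operator by the
     two-term recurrence: each one clears the leading term left over by the previous ones.\<close>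
  have "recurrence_operator ?c n
      = (N - 1) * r 0 + (6 - 2 * N) * r 1 - 20 * r 2 + 8 * (N - 2) * r 3 - 16 * (N - 4) * r 4"
    unfolding recurrence_operator_def r_def N_def[symmetric]
    by (simp add: algebra_simps power2_eq_square flip: numeral_2_eq_2)
  then show ?thesis by (simp add: r_zero)
qed

lemma operator_annihilates_palindromes:
  assumes "n \<ge> 6"
  shows "recurrence_operator num_palindromes n = 0"
proof -
  let ?p = num_palindromes
  define N where "N = int n"
  define r where "r i = (N - int i) * ?p (n - i) - 4 * (N - int i - 1) * ?p (n - Suc (Suc i))" for i
  have r_zero: "r i = 0" if "i \<le> 3" for i
    using num_palindromes_recurrence[of "n - i"] assms that
    by (simp add: r_def N_def numeral_2_eq_2)
  have "recurrence_operator ?p n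
      = (N - 1) * r 0 - 2 * (3 * N - 4) * r 1 + 4 * (3 * N - 10) * r 2 - 8 * (2 * N - 9) * r 3"
    unfolding recurrence_operator_def r_def N_def[symmetric]
    by (simp add: algebra_simps power2_eq_square flip: numeral_2_eq_2 numeral_3_eq_3)
  then show ?thesis by (simp add: r_zero)
qed

theorem theorem4:
  fixes n :: nat and a :: "nat \<Rightarrow> int"
  defines "a \<equiv> \<lambda>k. int (num_up_to_reversal k)"
  assumes "n \<ge> 6"
  shows "int n * (int n - 1) * a n
       - 2 * (int n - 1) * (3 * int n - 4) * a (n - 1)
       + 4 * (2 * (int n)^2 - 14 * int n + 19) * a (n - 2)
       + 8 * ((int n)^2 + 5 * int n - 19) * a (n - 3)
       - 16 * (int n - 3) * (3 * int n - 10) * a (n - 4)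
       + 32 * (int n - 4) * (2 * int n - 9) * a (n - 5) = 0"
proof -
  have twice_a: "2 * a k = central_binomial k + num_palindromes k" for k
    unfolding a_def by (rule twice_num_up_to_reversal)
  have "2 * recurrence_operator a n = recurrence_operator (\<lambda>k. 2 * a k) n"
    unfolding recurrence_operator_def by (simp add: algebra_simps power2_eq_square)
  also have "\<dots> = recurrence_operator central_binomial n + recurrence_operator num_palindromes n"
    unfolding twice_a recurrence_operator_def by (simp add: algebra_simps power2_eq_square)
  also have "\<dots> = 0"
    using assms(2) by (simp add: operator_annihilates_central operator_annihilates_palindromes)
  finally show ?thesis
    unfolding recurrence_operator_def by simp
qed

end
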